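(* Let $G$ be a connected graph and suppose there is a vertex $v$ of $G$ such that, for $S=N_G(v)$, the induced subcomplex $\mathcal{N}(G-\{v\})[S]$ is path connected. If $\mathcal{N}(G-\{v\})$ is simply connected, then $\mathcal{N}(G)$ is simply connected.
   Context: Graphs are finite, undirected, without loops or multiple edges. For a vertex $v$ of $G$, $N_G(v)$ is the set of vertices adjacent to $v$, and $G-\{v\}$ is the subgraph induced on $V(G)\setminus\{v\}$. The neighbourhood complex $\mathcal{N}(G)$ is the simplicial complex whose simplices are the subsets $\sigma\subseteq V(G)$ whose elements have a common neighbour in $G$, i.e. there is a vertex of $G$ adjacent to every element of $\sigma$. For a simplicial complex $X$ and a set $S$ of vertices, $X[S]$ denotes the induced subcomplex whose simplices are the $\sigma\in X$ with $\sigma\subseteq S$. Topological properties of a simplicial complex refer to its geometric realization. Simply connected means path connected with trivial fundamental group; path connected includes nonempty. *)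

theory Defs
  imports "Graph_Theory.Digraph_Component" "HOL-Analysis.Analysis"
begin

section \<open>Neighbourhood complexes of graphs\<close>

text \<open>Graphs are those of the AFP entry Graph_Theory: \<open>graph G\<close> says that \<open>G\<close> is a finite
  symmetric digraph without loops or parallel arcs.\<close>

definition neighbourhood :: "('a, 'b) pre_digraph \<Rightarrow> 'a \<Rightarrow> 'a set" where
  "neighbourhood G v = {u \<in> verts G. v \<rightarrow>\<^bsub>G\<^esub> u}"

text \<open>A simplicial complex is given by its set of simplices. The empty simplex belongs to every
  non-void complex; it contributes no point to the geometric realization.\<close>

definition nbhd_complex :: "('a, 'b) pre_digraph \<Rightarrow> 'a set set" where
  "nbhd_complex G = {\<sigma>. \<sigma> \<subseteq> verts G \<and> (\<exists>w \<in> verts G. \<forall>u \<in> \<sigma>. w \<rightarrow>\<^bsub>G\<^esub> u)}"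

definition induced_subcomplex :: "'a set set \<Rightarrow> 'a set \<Rightarrow> 'a set set" where
  "induced_subcomplex X S = {\<sigma> \<in> X. \<sigma> \<subseteq> S}"


section \<open>Geometric realization\<close>

text \<open>Barycentric coordinates. The realization carries the subspace topology of the product
  topology on \<open>'a \<Rightarrow> real\<close>. For a complex with finitely many vertices (the only case used here)
  this is the usual topology: all coordinates outside the finite vertex set vanish. Infinite
  supports are excluded, as the sum over an infinite set is 0 by convention.\<close>

definition realization :: "'a set set \<Rightarrow> ('a \<Rightarrow> real) set" where
  "realization X =
     {x. (\<forall>u. 0 \<le> x u) \<and> {u. x u \<noteq> 0} \<in> X \<and> (\<Sum>u \<in> {u. x u \<noteq> 0}. x u) = 1}"

text \<open>The library's \<open>path_connected\<close> and \<open>simply_connected\<close> hold of the empty set, so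
  nonemptiness has to be required separately.\<close>

definition path_connected_complex :: "'a set set \<Rightarrow> bool" where
  "path_connected_complex X \<longleftrightarrow> realization X \<noteq> {} \<and> path_connected (realization X)"

definition simply_connected_complex :: "'a set set \<Rightarrow> bool" where
  "simply_connected_complex X \<longleftrightarrow> realization X \<noteq> {} \<and> simply_connected (realization X)"

text \<open>The library defines \<open>simply_connected\<close> by free homotopy of loops. The following lemmas
  confirm that this means: path connected, with every based loop null-homotopic relative to its
  endpoints. (The library proves it only for normed spaces.)\<close>

lemma homotopic_loops_const_imp_homotopic_paths_const:
  fixes S :: "'a::topological_space set"
  assumes "homotopic_loops S p (\<lambda>_. a)"
  shows "homotopic_paths S p (\<lambda>_. pathstart p)"
proof -
  obtain h where h: "continuous_on ({0..1::real} \<times> {0..1::real}) h"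
      "h \<in> ({0..1} \<times> {0..1}) \<rightarrow> S" "\<And>x. x \<in> {0..1} \<Longrightarrow> h (0, x) = p x"
      "\<And>x. x \<in> {0..1} \<Longrightarrow> h (1, x) = a" 
      "\<And>t. t \<in> {0..1} \<Longrightarrow> h (t, 1) = h (t, 0)"
    using assms unfolding homotopic_loops by (auto simp: pathfinish_def pathstart_def)
  define f where "f t = min 1 (min (3 * t) (3 - 3 * t))" for t :: real
  define g where "g t = max 0 (min 1 (3 * t - 1))" for t :: real
  have fg: "f t \<in> {0..1}" "g t \<in> {0..1}" if "t \<in> {0..1}" for t
    using that by (auto simp: f_def g_def)
  have hf: "h (f t, g t) = h (f t, 0)" if t: "t \<in> {0..1}" for t
  proof (cases "f t = 1")
    case True
    then show ?thesis using h(4) fg(2)[OF t] by simp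
  next
    case False
    then have "g t = 0 \<or> g t = 1"
      by (auto simp: f_def g_def min_def max_def split: if_splits)
    then show ?thesis using h(5) fg(1)[OF t] by auto
  qed
  have cf: "continuous_on A f" and cg: "continuous_on A g" for A
    unfolding f_def g_def by (intro continuous_intros)+
  have fe: "f 0 = 0" "f 1 = 0" "g 0 = 0" "g 1 = 1"
    by (auto simp: f_def g_def)
  have 1: "homotopic_paths S p (\<lambda>t. h (f t, g t))"
    unfolding homotopic_paths
  proof (intro exI[where x = "\<lambda>z. h (fst z * f (snd z), (1 - fst z) * snd z + fst z * g (snd z))"] conjI ballI)
    have *: "(fst z * f (snd z), (1 - fst z) * snd z + fst z * g (snd z)) \<in> {0..1} \<times> {0..1}"
      if z: "z \<in> {0..1} \<times> {0..1}" for z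
    proof -
      have "(1 - fst z) * snd z + fst z * g (snd z) \<le> 1"
        using convex_bound_le[of "snd z" 1 "g (snd z)" "1 - fst z" "fst z"] z fg[of "snd z"] by auto
      then show ?thesis using z fg[of "snd z"] by (auto simp: mult_le_one)
    qed
    show "continuous_on ({0..1} \<times> {0..1})
        (\<lambda>z. h (fst z * f (snd z), (1 - fst z) * snd z + fst z * g (snd z)))"
    proof (rule continuous_on_compose2[OF h(1)])
      show "continuous_on ({0..1} \<times> {0..1})
          (\<lambda>z. (fst z * f (snd z), (1 - fst z) * snd z + fst z * g (snd z)))"
        by (intro continuous_intros continuous_on_compose2[OF cf] continuous_on_compose2[OF cg]) auto
    qed (use * in blast)
    show "(\<lambda>z. h (fst z * f (snd z), (1 - fst z) * snd z + fst z * g (snd z)))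
        \<in> {0..1} \<times> {0..1} \<rightarrow> S"
      using * h(2) by blast
  qed (use h(3) fe in \<open>auto simp: pathstart_def pathfinish_def\<close>)
  have 2: "homotopic_paths S (\<lambda>t. h (f t, g t)) (\<lambda>_. pathstart p)"
    unfolding homotopic_paths
  proof (intro exI[where x = "\<lambda>z. h ((1 - fst z) * f (snd z), 0)"] conjI ballI)
    have *: "((1 - fst z) * f (snd z), 0::real) \<in> {0..1} \<times> {0..1}" if "z \<in> {0..1} \<times> {0..1}" for z
      using that fg[of "snd z"] by (auto simp: mult_le_one)
    show "continuous_on ({0..1} \<times> {0..1}) (\<lambda>z. h ((1 - fst z) * f (snd z), 0))"
    proof (rule continuous_on_compose2[OF h(1)])
      show "continuous_on ({0..1} \<times> {0..1}) (\<lambda>z. ((1 - fst z) * f (snd z), 0::real))"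
        by (intro continuous_intros continuous_on_compose2[OF cf]) auto
    qed (use * in blast)
    show "(\<lambda>z. h ((1 - fst z) * f (snd z), 0)) \<in> {0..1} \<times> {0..1} \<rightarrow> S"
      using * h(2) by blast
  qed (use h(3) h(5)[of 0] hf fe in \<open>auto simp: pathstart_def pathfinish_def\<close>)
  show ?thesis
    using homotopic_paths_trans[OF 1 2] .
qed

lemma simply_connected_iff_trivial_loops:
  fixes S :: "'a::topological_space set"
  shows "simply_connected S \<longleftrightarrow> path_connected S \<and>
    (\<forall>p. path p \<and> path_image p \<subseteq> S \<and> pathfinish p = pathstart p
         \<longrightarrow> homotopic_paths S p (\<lambda>_. pathstart p))"
    (is "_ \<longleftrightarrow> _ \<and> ?trivial")
proof (intro iffI conjI)
  assume sc: "simply_connected S"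
  have cpath: "path (\<lambda>_. a)" "path_image (\<lambda>_. a) = {a}"
    "pathstart (\<lambda>_. a) = a" "pathfinish (\<lambda>_. a) = a" for a :: 'a
    by (auto simp: path_def path_image_def pathstart_def pathfinish_def)
  show "path_connected S"
    unfolding path_connected_def
  proof (intro ballI)
    fix a b assume "a \<in> S" "b \<in> S"
    then have "homotopic_loops S (\<lambda>_. a) (\<lambda>_. b)"
      using sc cpath unfolding simply_connected_def by simp
    then obtain h where h: "continuous_on ({0..1::real} \<times> {0..1::real}) h"
        "h \<in> ({0..1} \<times> {0..1}) \<rightarrow> S" "h (0, 0) = a" "h (1, 0) = b"
      unfolding homotopic_loops by auto
    have "continuous_on {0..1} (\<lambda>t. h (t, 0))"
      by (rule continuous_on_compose2[OF h(1)]) (auto intro!: continuous_intros)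
    then show "\<exists>g. path g \<and> path_image g \<subseteq> S \<and> pathstart g = a \<and> pathfinish g = b"
      using h by (intro exI[where x = "\<lambda>t. h (t, 0)"])
        (auto simp: path_def path_image_def pathstart_def pathfinish_def)
  qed
  show ?trivial
  proof (intro allI impI)
    fix p assume p: "path p \<and> path_image p \<subseteq> S \<and> pathfinish p = pathstart p"
    then have "pathstart p \<in> S"
      using pathstart_in_path_image by blast
    then have "homotopic_loops S p (\<lambda>_. pathstart p)"
      using sc p cpath unfolding simply_connected_def by simp
    then show "homotopic_paths S p (\<lambda>_. pathstart p)"
      by (rule homotopic_loops_const_imp_homotopic_paths_const)
  qed
next
  assume R: "path_connected S \<and> ?trivial"
  show "simply_connected S"
    unfolding simply_connected_def
  proof (intro allI impI)
    fix p q
    assume pq: "path p \<and> pathfinish p = pathstart p \<and> path_image p \<subseteq> S \<and>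
      path q \<and> pathfinish q = pathstart q \<and> path_image q \<subseteq> S"
    have loop: "homotopic_loops S r (\<lambda>_. pathstart r)"
      if "path r" "path_image r \<subseteq> S" "pathfinish r = pathstart r" for r
    proof (rule homotopic_paths_imp_homotopic_loops)
      show "homotopic_paths S r (\<lambda>_. pathstart r)" using R that by blast
    qed (use that in \<open>auto simp: pathstart_def pathfinish_def\<close>)
    have "pathstart p \<in> S" "pathstart q \<in> S"
      using pq pathstart_in_path_image by blast+
    then obtain g where g: "path g" "path_image g \<subseteq> S" "pathstart g = pathstart p"
        "pathfinish g = pathstart q"
      using R unfolding path_connected_def by metis
    have "homotopic_loops S (\<lambda>_. pathstart p) (\<lambda>_. pathstart q)"
      unfolding homotopic_loops
    proof (intro exI[where x = "g \<circ> fst"] conjI)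
      show "continuous_on ({0..1::real} \<times> {0..1::real}) (g \<circ> fst)"
        using g(1) unfolding path_def
        by (intro continuous_on_compose continuous_intros) (auto elim: continuous_on_subset)
    qed (use g in \<open>auto simp: path_image_def pathstart_def pathfinish_def\<close>)
    then show "homotopic_loops S p q"
      using loop[of p] loop[of q] pq
      by (meson homotopic_loops_sym homotopic_loops_trans)
  qed
qed

end

theory Submission
  imports Defs
begin

text \<open>Put \<open>L = N(G - v)\<close> and \<open>S = N\<^sub>G(v)\<close>. Then \<open>N(G)\<close> arises from \<open>L\<close> by attaching first the full simplex on
  \<open>S\<close>, which meets \<open>L\<close> in \<open>L[S]\<close>, and then the closed star of \<open>v\<close>, which meets the rest in the link of
  \<open>v\<close>, the union of the simplices on \<open>N\<^sub>G(w) - {v}\<close> with \<open>w \<in> S\<close>. If \<open>w, w' \<in> S\<close> span an edge of \<open>L\<close>,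
  their simplices share a vertex, so connectedness of \<open>L[S]\<close> makes the link connected. The attached
  pieces are cones, so the simply connected case of van Kampen's theorem applies twice.\<close>

section \<open>Unions of simply connected sets\<close>

text \<open>The loop \<open>p +++ reversepath q\<close> contracts over a square; sweeping that
  square out by segments that end at the joint of the loop turns the contraction into a homotopy
  from \<open>p\<close> to \<open>q\<close>.\<close>

lemma simply_connected_imp_homotopic_paths:
  fixes S :: "'a::topological_space set"
  assumes sc: "simply_connected S"
    and p: "path p" "path_image p \<subseteq> S" and q: "path q" "path_image q \<subseteq> S"
    and ends: "pathstart q = pathstart p" "pathfinish q = pathfinish p"
  shows "homotopic_paths S p q"
proof -
  define l where "l = p +++ reversepath q"
  have "path l" "path_image l \<subseteq> S" "pathfinish l = pathstart l"
    using p q ends by (auto simp: l_def path_image_join)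
  then have "homotopic_paths S l (\<lambda>_. pathstart l)"
    using sc by (simp add: simply_connected_iff_trivial_loops)
  then obtain h where h: "continuous_on ({0..1::real} \<times> {0..1::real}) h"
      "h \<in> ({0..1} \<times> {0..1}) \<rightarrow> S" "\<And>s. s \<in> {0..1} \<Longrightarrow> h (0, s) = l s"
      "\<And>s. s \<in> {0..1} \<Longrightarrow> h (1, s) = pathstart p"
      "\<And>t. t \<in> {0..1} \<Longrightarrow> h (t, 0) = pathstart p" "\<And>t. t \<in> {0..1} \<Longrightarrow> h (t, 1) = pathstart p"
    using ends unfolding homotopic_paths by (auto simp: l_def pathstart_def pathfinish_def joinpaths_def reversepath_def)
  \<comment> \<open>\<open>(f, g)\<close> runs along the three sides of the square on which \<open>h\<close> is constant; the homotopy
    shrinks this curve towards the point \<open>(0, 1/2)\<close> of the fourth side.\<close>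
  define f where "f t = min 1 (min (3 * t) (3 - 3 * t))" for t :: real
  define g where "g t = max 0 (min 1 (3 * t - 1))" for t :: real
  have fg: "f t \<in> {0..1}" "g t \<in> {0..1}" if "t \<in> {0..1}" for t
    using that by (auto simp: f_def g_def)
  have hf: "h (f t, g t) = pathstart p" if t: "t \<in> {0..1}" for t
  proof -
    have "f t = 1 \<or> g t = 0 \<or> g t = 1"
      by (auto simp: f_def g_def min_def max_def split: if_splits)
    then show ?thesis using h(4-6) fg[OF t] by auto
  qed
  have cf: "continuous_on A f" and cg: "continuous_on A g" for A
    unfolding f_def g_def by (intro continuous_intros)+
  have fe: "f 0 = 0" "f 1 = 0" "g 0 = 0" "g 1 = 1"
    by (auto simp: f_def g_def)
  \<comment> \<open>For \<open>z = (t, s)\<close> this is the point at parameter \<open>s\<close> on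
    the segment from \<open>(f t, g t)\<close> to \<open>(0, 1/2)\<close>. At its two ends
    \<open>h\<close> equals \<open>pathstart p\<close> and \<open>l (1/2) = pathfinish p\<close>.
    For \<open>t = 0\<close> the segment is the half side carrying \<open>p\<close>; for
    \<open>t = 1\<close> it is the half carrying \<open>reversepath q\<close>, traversed
    backwards.\<close>
  define k where "k z = ((1 - snd z) * f (fst z), 1/2 + (1 - snd z) * (g (fst z) - 1/2))" for z :: "real \<times> real"
  have k: "k z \<in> {0..1} \<times> {0..1}" if z: "z \<in> {0..1} \<times> {0..1}" for z
  proof -
    have "\<bar>(1 - snd z) * (g (fst z) - 1/2)\<bar> \<le> 1 * (1/2)"
      unfolding abs_mult
    proof (rule mult_mono)
      show "\<bar>1 - snd z\<bar> \<le> 1" using z by auto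
      have "fst z \<in> {0..1}" using z by auto
      then show "\<bar>g (fst z) - 1/2\<bar> \<le> 1/2" using fg(2)[of "fst z"] unfolding atLeastAtMost_iff by linarith
    qed auto
    then show ?thesis using z fg[of "fst z"] by (auto simp: k_def mult_le_one abs_le_iff)
  qed
  show ?thesis
    unfolding homotopic_paths
  proof (intro exI[where x = "h \<circ> k"] conjI ballI)
    have "continuous_on ({0..1} \<times> {0..1}) k"
      unfolding k_def by (intro continuous_intros continuous_on_compose2[OF cf] continuous_on_compose2[OF cg]) auto
    then show "continuous_on ({0..1} \<times> {0..1}) (h \<circ> k)"
      by (intro continuous_on_compose continuous_on_subset[OF h(1)] image_subsetI k)
    show "h \<circ> k \<in> {0..1} \<times> {0..1} \<rightarrow> S"
      using k funcset_mem[OF h(2)] by (intro funcsetI) (simp only: o_apply)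
    show "(h \<circ> k) (0, s) = p s" if "s \<in> {0..1}" for s
    proof -
      have "k (0, s) = (0, s/2)" by (simp add: k_def fe field_simps)
      then show ?thesis using that h(3)[of "s/2"] by (simp add: l_def joinpaths_def)
    qed
    show "(h \<circ> k) (1, s) = q s" if s: "s \<in> {0..1}" for s
    proof -
      have "k (1, s) = (0, 1 - s/2)" by (simp add: k_def fe field_simps)
      then have "(h \<circ> k) (1, s) = l (1 - s/2)" using s h(3)[of "1 - s/2"] by simp
      also have "\<dots> = q s"
      \<comment> \<open>At \<open>s = 1\<close> the argument is \<open>1/2\<close>, where
        \<open>+++\<close> still evaluates its first path, so the common endpoint of
        \<open>p\<close> and \<open>q\<close> enters.\<close>
      proof (cases "s = 1")
        case True
        then show ?thesis using ends by (simp add: l_def joinpaths_def pathfinish_def)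
      next
        case False
        then show ?thesis using s by (simp add: l_def joinpaths_def reversepath_def algebra_simps)
      qed
      finally show ?thesis .
    qed
    show "pathstart (h \<circ> k \<circ> Pair t) = pathstart p" if "t \<in> {0..1}" for t
      using hf[OF that] by (simp add: k_def pathstart_def)
    show "pathfinish (h \<circ> k \<circ> Pair t) = pathfinish p" if "t \<in> {0..1}" for t
      using h(3)[of "1/2"] by (simp add: k_def pathfinish_def l_def joinpaths_def)
  qed
qed

text \<open>Reduces simple connectedness to paths issuing from one point \<open>x0\<close>. A loop
  \<open>p\<close> elsewhere is reached from \<open>x0\<close> by a path \<open>c\<close>; a
  homotopy from \<open>c +++ p\<close> to \<open>c\<close>, restricted to suitable curves in the
  square, contracts \<open>p\<close> freely.\<close>

lemma simply_connectedI_basepoint: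
  fixes S :: "'a::topological_space set"
  assumes pc: "path_connected S" and x0: "x0 \<in> S"
    and hom: "\<And>p q. \<lbrakk>path p; path_image p \<subseteq> S; path q; path_image q \<subseteq> S; pathstart p = x0;
      pathstart q = x0; pathfinish p = pathfinish q\<rbrakk> \<Longrightarrow> homotopic_paths S p q"
  shows "simply_connected S"
  unfolding simply_connected_iff_trivial_loops
proof (intro conjI allI impI pc)
  fix p assume p: "path p \<and> path_image p \<subseteq> S \<and> pathfinish p = pathstart p"
  then have "pathstart p \<in> S" using pathstart_in_path_image by blast
  then obtain c where c: "path c" "path_image c \<subseteq> S" "pathstart c = x0" "pathfinish c = pathstart p"
    using pc x0 unfolding path_connected_def by metis
  have "homotopic_paths S (c +++ p) c"
    using c p by (intro hom) (auto simp: path_image_join)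
  then obtain h where h: "continuous_on ({0..1::real} \<times> {0..1::real}) h"
      "h \<in> ({0..1} \<times> {0..1}) \<rightarrow> S" "\<And>s. s \<in> {0..1} \<Longrightarrow> h (0, s) = (c +++ p) s"
      "\<And>s. s \<in> {0..1} \<Longrightarrow> h (1, s) = c s"
      "\<And>t. t \<in> {0..1} \<Longrightarrow> h (t, 0) = x0" "\<And>t. t \<in> {0..1} \<Longrightarrow> h (t, 1) = pathstart p"
    using c p unfolding homotopic_paths by (auto simp: pathstart_def pathfinish_def joinpaths_def)
  have c1: "c 1 = p 0" using c by (simp add: pathstart_def pathfinish_def)
  have cp: "(c +++ p) ((1 + s) / 2) = p s" if "s \<in> {0..1}" for s
    using that c1 by (cases "s = 0") (auto simp: joinpaths_def add_divide_distrib)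
  \<comment> \<open>The half side carrying \<open>p\<close> is turned about \<open>(0, 1/2)\<close>.
    Its other end moves along the edge where \<open>h\<close> is \<open>pathstart p\<close>, which
    is also \<open>h (0, 1/2)\<close>, so every stage is a loop.\<close>
  have 1: "homotopic_loops S p (\<lambda>s. h (s, (1 + s) / 2))"
    unfolding homotopic_loops
  proof (intro exI[where x = "\<lambda>z. h (fst z * snd z, (1 + snd z) / 2)"] conjI ballI)
    have *: "(fst z * snd z, (1 + snd z) / 2) \<in> {0..1} \<times> {0..1}" if "z \<in> {0..1} \<times> {0..1}" for z :: "real \<times> real"
      using that by (auto simp: mult_le_one)
    show "continuous_on ({0..1} \<times> {0..1}) (\<lambda>z. h (fst z * snd z, (1 + snd z) / 2))"
      by (rule continuous_on_compose2[OF h(1)]) (use * in \<open>auto intro!: continuous_intros\<close>)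
    show "(\<lambda>z. h (fst z * snd z, (1 + snd z) / 2)) \<in> {0..1} \<times> {0..1} \<rightarrow> S"
      using * h(2) by blast
  qed (use h cp c1 in \<open>auto simp: pathstart_def pathfinish_def joinpaths_def\<close>)
  \<comment> \<open>The segment from \<open>(0, 1/2)\<close> to \<open>(1, 1)\<close> is lowered to
    the edge where \<open>h\<close> is \<open>x0\<close>. At time \<open>t\<close> both of its ends
    have the value \<open>c (1 - t)\<close>, so the stages are again loops.\<close>
  have 2: "homotopic_loops S (\<lambda>s. h (s, (1 + s) / 2)) (\<lambda>_. x0)"
    unfolding homotopic_loops
  proof (intro exI[where x = "\<lambda>z. h (snd z, (1 - fst z) * ((1 + snd z) / 2))"] conjI ballI)
    have *: "(snd z, (1 - fst z) * ((1 + snd z) / 2)) \<in> {0..1} \<times> {0..1}"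
      if "z \<in> {0..1} \<times> {0..1}" for z :: "real \<times> real"
    proof -
      have "(1 - fst z) * ((1 + snd z) / 2) \<le> 1" using that by (intro mult_le_one) auto
      then show ?thesis using that by auto
    qed
    show "continuous_on ({0..1} \<times> {0..1}) (\<lambda>z. h (snd z, (1 - fst z) * ((1 + snd z) / 2)))"
      by (rule continuous_on_compose2[OF h(1)]) (use * in \<open>auto intro!: continuous_intros\<close>)
    show "(\<lambda>z. h (snd z, (1 - fst z) * ((1 + snd z) / 2))) \<in> {0..1} \<times> {0..1} \<rightarrow> S"
      using * h(2) by blast
  qed (use h in \<open>auto simp: pathstart_def pathfinish_def joinpaths_def diff_divide_distrib\<close>)
  show "homotopic_paths S p (\<lambda>_. pathstart p)"
    using homotopic_loops_const_imp_homotopic_paths_const[OF homotopic_loops_trans[OF 1 2]] .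
qed

text \<open>The library's \<open>subpath\<close> is restricted to normed spaces.\<close>

definition path_segment :: "real \<Rightarrow> real \<Rightarrow> (real \<Rightarrow> 'a) \<Rightarrow> real \<Rightarrow> 'a" where
  "path_segment a b p = (\<lambda>x. p ((b - a) * x + a))"

lemma path_segment_ends [simp]:
  "pathstart (path_segment a b p) = p a" "pathfinish (path_segment a b p) = p b"
  by (auto simp: pathstart_def pathfinish_def path_segment_def)

lemma path_image_path_segment:
  fixes p :: "real \<Rightarrow> 'a::topological_space"
  assumes "path p" "0 \<le> a" "a \<le> b" "b \<le> 1"
  shows "path (path_segment a b p)" "path_image (path_segment a b p) = p ` {a..b}"
proof -
  have im: "(\<lambda>x. (b - a) * x + a) ` {0..1} = {a..b}"
    using assms image_affinity_atLeastAtMost[of "b - a" a 0 1] by auto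
  show "path_image (path_segment a b p) = p ` {a..b}"
    unfolding im[symmetric] by (simp add: path_image_def path_segment_def image_image)
  show "path (path_segment a b p)"
    unfolding path_def path_segment_def
    by (rule continuous_on_compose2[OF assms(1)[unfolded path_def]])
       (use im assms in \<open>auto intro!: continuous_intros\<close>)
qed

text \<open>Both sides run through the same points at different speeds: \<open>f\<close> maps the
  first half of the unit interval onto \<open>[0, a / b]\<close> and the second onto
  \<open>[a / b, 1]\<close>. For \<open>b = 0\<close> both paths are constant.\<close>

lemma homotopic_segment_join:
  fixes p :: "real \<Rightarrow> 'a::topological_space"
  assumes "path p" "path_image p \<subseteq> S" and ab: "0 \<le> a" "a \<le> b" "b \<le> 1"
  shows "homotopic_paths S (path_segment 0 b p) (path_segment 0 a p +++ path_segment a b p)"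
proof (cases "b = 0")
  case True
  then show ?thesis
    using assms by (auto simp: path_image_def path_segment_def joinpaths_def path_def)
next
  case False
  define f where "f t = (if t \<le> 1/2 then 2 * t * a else a + (2 * t - 1) * (b - a)) / b" for t
  show ?thesis
  proof (rule homotopic_paths_reparametrize[where f = f])
    show "path (path_segment 0 b p)" "path_image (path_segment 0 b p) \<subseteq> S"
      using path_image_path_segment[OF assms(1), of 0 b] assms by (auto simp: path_image_def)
    show "continuous_on {0..1} f"
      unfolding f_def split_01 using False
      by (intro continuous_intros continuous_on_cases) (auto simp: mult.commute[of _ 2])
    show "f \<in> {0..1} \<rightarrow> {0..1}"
    proof
      fix t :: real assume t: "t \<in> {0..1}"
      have "2 * t * a \<le> 1 * b" if "t \<le> 1/2" using that t ab by (intro mult_mono) auto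
      moreover have "(2 * t - 1) * (b - a) \<le> 1 * (b - a)" using t ab by (intro mult_right_mono) auto
      ultimately show "f t \<in> {0..1}" using t ab False by (auto simp: f_def)
    qed
    show "(path_segment 0 a p +++ path_segment a b p) t = path_segment 0 b p (f t)" for t
      using False by (simp add: path_segment_def joinpaths_def f_def algebra_simps)
  qed (use False in \<open>auto simp: f_def\<close>)
qed

text \<open>The simply connected case of the Seifert-van Kampen theorem. Two paths from
  \<open>x0\<close> with a common endpoint can be pushed into the same one of the two sets, where
  they are homotopic.\<close>

theorem simply_connected_Un_open:
  fixes A B :: "'a::topological_space set"
  assumes opA: "openin (top_of_set (A \<union> B)) A" and opB: "openin (top_of_set (A \<union> B)) B"
    and scA: "simply_connected A" and scB: "simply_connected B"
    and pc: "path_connected (A \<inter> B)" and ne: "A \<inter> B \<noteq> {}"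
  shows "simply_connected (A \<union> B)"
proof -
  obtain x0 where x0: "x0 \<in> A" "x0 \<in> B" using ne by blast
  \<comment> \<open>A path starting at \<open>x0\<close> can be pushed into either of the two sets that contains its endpoint:
    extend the pushed path piecewise, and change sets by replacing it with a path in \<open>A \<inter> B\<close>.\<close>
  have push: "\<exists>q. path q \<and> path_image q \<subseteq> U \<and> homotopic_paths (A \<union> B) p q"
    if p: "path p" "path_image p \<subseteq> A \<union> B" "pathstart p = x0"
      and U: "U \<in> {A, B}" "pathfinish p \<in> U" for p U
  proof -
    \<comment> \<open>A pushed copy of the initial segment is demanded in every set containing
      \<open>p t\<close>, because the next piece of \<open>p\<close> may continue in either of
      them.\<close>
    define C where "C t \<longleftrightarrow> (\<forall>U\<in>{A, B}. p t \<in> U \<longrightarrow>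
      (\<exists>q. path q \<and> path_image q \<subseteq> U \<and> homotopic_paths (A \<union> B) (path_segment 0 t p) q))" for t
    have pS: "p t \<in> A \<union> B" if "t \<in> {0..1}" for t
      using p(2) that by (force simp: path_image_def)
    have step: "C b" if Ca: "C a" and ab: "0 \<le> a" "a \<le> b" "b \<le> 1"
      and U: "U \<in> {A, B}" "p ` {a..b} \<subseteq> U" for a b U
    proof -
      have "p a \<in> U" using U ab by auto
      then obtain q where q: "path q" "path_image q \<subseteq> U" "homotopic_paths (A \<union> B) (path_segment 0 a p) q"
        using bspec[OF Ca[unfolded C_def] U(1)] by auto
      have sub: "path (path_segment a b p)" "path_image (path_segment a b p) \<subseteq> U"
        using path_image_path_segment[OF p(1) ab] U by auto
      have qe: "pathstart q = x0" "pathfinish q = p a"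
        using homotopic_paths_imp_pathstart[OF q(3)] homotopic_paths_imp_pathfinish[OF q(3)] p(3)
        by (simp_all add: pathstart_def[of p])
      define r where "r = q +++ path_segment a b p"
      have r: "path r" "path_image r \<subseteq> U" "pathstart r = x0" "pathfinish r = p b"
        using q sub qe by (auto simp: r_def path_image_join)
      have "homotopic_paths (A \<union> B) (path_segment 0 a p +++ path_segment a b p) r"
        unfolding r_def
        by (rule homotopic_paths_join[OF q(3)]) (use sub U in auto)
      then have hr: "homotopic_paths (A \<union> B) (path_segment 0 b p) r"
        by (rule homotopic_paths_trans[OF homotopic_segment_join[OF p(1,2) ab]])
      show ?thesis
        unfolding C_def
      proof (intro ballI impI)
        fix W assume W: "W \<in> {A, B}" "p b \<in> W"
        show "\<exists>q. path q \<and> path_image q \<subseteq> W \<and> homotopic_paths (A \<union> B) (path_segment 0 b p) q"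
        proof (cases "W = U")
          case True
          then show ?thesis using r hr by blast
        next
          case False
          have "p b \<in> U" using U ab by auto
          then have "p b \<in> A \<inter> B" using U W False by auto
          then obtain c where c: "path c" "path_image c \<subseteq> A \<inter> B" "pathstart c = x0" "pathfinish c = p b"
            using pc x0 unfolding path_connected_def by (metis IntI)
          \<comment> \<open>Both paths lie in the simply connected \<open>U\<close>, while
            \<open>c\<close> lies in \<open>W\<close> as well; this is the change of sets.\<close>
          have "homotopic_paths U r c"
            using r c U scA scB by (intro simply_connected_imp_homotopic_paths) auto
          then have "homotopic_paths (A \<union> B) r c"
            by (rule homotopic_paths_subset) (use U in auto)
          then show ?thesis using c W homotopic_paths_trans[OF hr] by (intro exI[of _ c]) auto
        qed
      qed
    qed
    have nbhd: "\<exists>d>0. \<forall>t\<in>{0..1}. \<bar>t - x\<bar> < d \<longrightarrow> p t \<in> U"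
      if x: "x \<in> {0..1}" "p x \<in> U" and U: "U \<in> {A, B}" for x U
    proof -
      obtain T where T: "open T" "U = (A \<union> B) \<inter> T"
        using opA opB U unfolding openin_open by blast
      have "continuous_on {0..1} p" using p by (simp add: path_def)
      then obtain W where W: "open W" "W \<inter> {0..1} = p -` T \<inter> {0..1}"
        using T(1) unfolding continuous_on_open_invariant by blast
      have "p x \<in> T" using x T by blast
      then have "x \<in> W" using x(1) W(2) by blast
      then obtain d where d: "d > 0" "ball x d \<subseteq> W" using W(1) openE by blast
      have "p t \<in> U" if "t \<in> {0..1}" "\<bar>t - x\<bar> < d" for t
      proof -
        have "t \<in> W" using d that by (auto simp: dist_real_def abs_minus_commute)
        then have "p t \<in> T" using W(2) that(1) by blast
        then show ?thesis using that(1) T(2) pS by blast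
      qed
      then show ?thesis using d by blast
    qed
    have C0: "C 0"
      unfolding C_def
    proof (intro ballI impI exI conjI)
      have "homotopic_paths (A \<union> B) (path_segment 0 0 p) (path_segment 0 0 p)"
        using path_image_path_segment[OF p(1), of 0 0] pS[of 0] by simp
      then show "homotopic_paths (A \<union> B) (path_segment 0 0 p) (\<lambda>_. p 0)"
        by (simp add: path_segment_def)
    qed (auto simp: path_def path_image_def)
    \<comment> \<open>Bisection takes the place of a subdivision by a Lebesgue number:
      \<open>C\<close> passes across every short interval around each \<open>x\<close>, hence from 0
      to 1. The guards in \<open>P\<close> confine the intervals to \<open>[0, 1]\<close>.\<close>
    have "0 \<le> (0::real) \<longrightarrow> (1::real) \<le> 1 \<longrightarrow> (0::real) \<le> 1 \<longrightarrow> C 0 \<longrightarrow> C 1"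
    proof (rule Bolzano[where P = "\<lambda>a b. 0 \<le> a \<longrightarrow> b \<le> 1 \<longrightarrow> a \<le> b \<longrightarrow> C a \<longrightarrow> C b" and a = 0 and b = 1])
      fix x :: real assume "0 \<le> x" "x \<le> 1"
      then have "x \<in> {0..1}" by simp
      with pS obtain U where U: "U \<in> {A, B}" "p x \<in> U" by blast
      obtain d where d: "d > 0" "\<And>t. \<lbrakk>t \<in> {0..1}; \<bar>t - x\<bar> < d\<rbrakk> \<Longrightarrow> p t \<in> U"
        using nbhd[OF \<open>x \<in> {0..1}\<close> U(2,1)] by blast
      show "\<exists>d>0. \<forall>a b. a \<le> x \<and> x \<le> b \<and> b - a < d \<longrightarrow> 0 \<le> a \<longrightarrow> b \<le> 1 \<longrightarrow> a \<le> b \<longrightarrow> C a \<longrightarrow> C b"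
      proof (intro exI[of _ d] conjI allI impI)
        fix a b assume *: "a \<le> x \<and> x \<le> b \<and> b - a < d" "0 \<le> a" "b \<le> 1" "a \<le> b" "C a"
        have "p ` {a..b} \<subseteq> U" using * by (auto intro!: d(2))
        then show "C b" using step[OF *(5) *(2) *(4) *(3) U(1)] by blast
      qed (use d in auto)
    qed auto
    then have "C 1" using C0 by simp
    then show ?thesis using bspec[OF _ U(1), of "\<lambda>U. p 1 \<in> U \<longrightarrow> _ U"] U(2)
      unfolding C_def by (simp add: pathfinish_def path_segment_def)
  qed
  show ?thesis
  proof (rule simply_connectedI_basepoint[of _ x0])
    show "path_connected (A \<union> B)"
      using scA scB ne by (intro path_connected_Un) (auto simp: simply_connected_iff_trivial_loops)
    fix p q assume pq: "path p" "path_image p \<subseteq> A \<union> B" "path q" "path_image q \<subseteq> A \<union> B"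
      "pathstart p = x0" "pathstart q = x0" "pathfinish p = pathfinish q"
    have "pathfinish p \<in> A \<union> B" using pq pathfinish_in_path_image by blast
    then obtain U where U: "U \<in> {A, B}" "pathfinish p \<in> U" by blast
    obtain p' where p': "path p'" "path_image p' \<subseteq> U" "homotopic_paths (A \<union> B) p p'"
      using push[OF pq(1,2,5) U] by blast
    obtain q' where q': "path q'" "path_image q' \<subseteq> U" "homotopic_paths (A \<union> B) q q'"
      using push[OF pq(3,4,6)] U pq(7) by metis
    have "homotopic_paths U p' q'"
      using p' q' U scA scB pq homotopic_paths_imp_pathstart[OF p'(3)] homotopic_paths_imp_pathstart[OF q'(3)]
        homotopic_paths_imp_pathfinish[OF p'(3)] homotopic_paths_imp_pathfinish[OF q'(3)]
      by (intro simply_connected_imp_homotopic_paths) auto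
    then have "homotopic_paths (A \<union> B) p' q'"
      by (rule homotopic_paths_subset) (use U in auto)
    then show "homotopic_paths (A \<union> B) p q"
      using p' q' by (meson homotopic_paths_sym homotopic_paths_trans)
  qed (use x0 in auto)
qed

section \<open>Transfer along a deformation into a subset\<close>

lemma simply_connected_deformation:
  fixes S T :: "'a::topological_space set"
  assumes cont: "continuous_on ({0..1::real} \<times> S) D"
    and S: "\<And>t x. \<lbrakk>t \<in> {0..1}; x \<in> S\<rbrakk> \<Longrightarrow> D (t, x) \<in> S"
    and D: "\<And>x. x \<in> S \<Longrightarrow> D (0, x) = x" "\<And>x. x \<in> S \<Longrightarrow> D (1, x) \<in> T"
    and T: "T \<subseteq> S" "simply_connected T"
  shows "simply_connected S"
  unfolding simply_connected_def
proof (intro allI impI)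
  fix p q
  assume pq: "path p \<and> pathfinish p = pathstart p \<and> path_image p \<subseteq> S \<and>
    path q \<and> pathfinish q = pathstart q \<and> path_image q \<subseteq> S"
  \<comment> \<open>\<open>D\<close> may move the base point of a loop, so loops are compared by
    free homotopies.\<close>
  have push: "homotopic_loops S r (\<lambda>s. D (1, r s))"
    if r: "path r" "path_image r \<subseteq> S" "pathfinish r = pathstart r" for r
    unfolding homotopic_loops
  proof (intro exI[where x = "\<lambda>z. D (fst z, r (snd z))"] conjI ballI)
    have "continuous_on {0..1} r" using r by (simp add: path_def)
    then have "continuous_on ({0..1} \<times> {0..1::real}) (\<lambda>z. r (snd z))"
      by (rule continuous_on_compose2) (auto intro!: continuous_intros)
    then have "continuous_on ({0..1::real} \<times> {0..1}) (\<lambda>z. (fst z, r (snd z)))"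
      by (intro continuous_on_Pair continuous_on_fst continuous_on_id)
    then show "continuous_on ({0..1} \<times> {0..1}) (\<lambda>z. D (fst z, r (snd z)))"
      by (rule continuous_on_compose2[OF cont]) (use r in \<open>auto simp: path_image_def\<close>)
  qed (use r S D in \<open>auto simp: path_image_def pathstart_def pathfinish_def image_subset_iff\<close>)
  have "homotopic_loops T (\<lambda>s. D (1, p s)) (\<lambda>s. D (1, q s))"
  proof -
    have "path (\<lambda>s. D (1, r s)) \<and> path_image (\<lambda>s. D (1, r s)) \<subseteq> T" if "path r" "path_image r \<subseteq> S" for r
      using that D unfolding path_def path_image_def
      by (auto intro!: continuous_on_compose2[OF cont] continuous_intros)
    then show ?thesis
      using T(2) pq unfolding simply_connected_def by (simp add: pathstart_def pathfinish_def)
  qed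
  then have "homotopic_loops S (\<lambda>s. D (1, p s)) (\<lambda>s. D (1, q s))"
    using T(1) homotopic_loops_subset by blast
  then show "homotopic_loops S p q"
    using push pq by (meson homotopic_loops_sym homotopic_loops_trans)
qed

lemma path_connected_deformation:
  fixes S T :: "'a::topological_space set"
  assumes cont: "continuous_on ({0..1::real} \<times> S) D"
    and S: "\<And>t x. \<lbrakk>t \<in> {0..1}; x \<in> S\<rbrakk> \<Longrightarrow> D (t, x) \<in> S"
    and D: "\<And>x. x \<in> S \<Longrightarrow> D (0, x) = x" "\<And>x. x \<in> S \<Longrightarrow> D (1, x) \<in> T"
    and T: "T \<subseteq> S" "path_connected T"
  shows "path_connected S"
proof -
  have push: "path_component S x (D (1, x))" if "x \<in> S" for x
    unfolding path_component_def
  proof (intro exI[where x = "\<lambda>t. D (t, x)"] conjI)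
    show "path (\<lambda>t. D (t, x))"
      unfolding path_def using that by (auto intro!: continuous_on_compose2[OF cont] continuous_intros)
  qed (use that S D in \<open>auto simp: path_image_def pathstart_def pathfinish_def\<close>)
  have "path_component S x y" if "x \<in> S" "y \<in> S" for x y
  proof -
    have "path_component T (D (1, x)) (D (1, y))"
      using T(2) D that by (simp add: path_connected_component)
    then have "path_component S (D (1, x)) (D (1, y))"
      using T(1) path_component_of_subset by blast
    then show ?thesis using push that path_component_sym path_component_trans by metis
  qed
  then show ?thesis by (simp add: path_connected_component)
qed


section \<open>Subcomplexes of finite complexes\<close>

definition finite_complex :: "'a set set \<Rightarrow> bool" where
  "finite_complex X \<longleftrightarrow> finite (\<Union>X) \<and> (\<forall>\<sigma>\<in>X. \<forall>\<tau>. \<tau> \<subseteq> \<sigma> \<longrightarrow> \<tau> \<in> X)"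

lemma finite_complexD:
  assumes "finite_complex X"
  shows "finite (\<Union>X)" "\<And>\<sigma> \<tau>. \<lbrakk>\<sigma> \<in> X; \<tau> \<subseteq> \<sigma>\<rbrakk> \<Longrightarrow> \<tau> \<in> X"
  using assms unfolding finite_complex_def by blast+

lemma finite_complex_Un: "finite_complex X \<Longrightarrow> finite_complex Y \<Longrightarrow> finite_complex (X \<union> Y)"
  and finite_complex_Int: "finite_complex X \<Longrightarrow> finite_complex Y \<Longrightarrow> finite_complex (X \<inter> Y)"
proof -
  assume X: "finite_complex X" and Y: "finite_complex Y"
  then show "finite_complex (X \<union> Y)"
    unfolding finite_complex_def by auto
  have "\<Union>(X \<inter> Y) \<subseteq> \<Union>X" by blast
  with X Y show "finite_complex (X \<inter> Y)"
    unfolding finite_complex_def by (auto intro: finite_subset)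
qed

text \<open>Summing over a fixed finite set \<open>V\<close> instead of the support makes the
  normalisation linear in \<open>x\<close>, as needed for convex combinations and
  truncations.\<close>

lemma realization_iff:
  assumes "finite V" "\<Union>X \<subseteq> V"
  shows "x \<in> realization X \<longleftrightarrow> (\<forall>u. 0 \<le> x u) \<and> {u. x u \<noteq> 0} \<in> X \<and> sum x V = 1"
proof -
  have "sum x {u. x u \<noteq> 0} = sum x V" if "{u. x u \<noteq> 0} \<in> X"
    using that assms by (intro sum.mono_neutral_left) auto
  then show ?thesis unfolding realization_def by auto
qed

lemma realization_mono: "X \<subseteq> Y \<Longrightarrow> realization X \<subseteq> realization Y"
  unfolding realization_def by auto

section \<open>Line segments in a realization\<close>

definition straight :: "real \<Rightarrow> ('a \<Rightarrow> real) \<Rightarrow> ('a \<Rightarrow> real) \<Rightarrow> 'a \<Rightarrow> real" where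
  "straight t x y = (\<lambda>u. (1 - t) * x u + t * y u)"

lemma straight_0_1 [simp]: "straight 0 x y = x" "straight 1 x y = y"
  by (simp_all add: straight_def)

text \<open>A convex combination is supported in the union of the two supports, so it is enough that
  this union is a simplex.\<close>

lemma straight_in_realization:
  assumes X: "finite_complex X" and x: "x \<in> realization X" and y: "y \<in> realization X"
    and xy: "{u. x u \<noteq> 0} \<union> {u. y u \<noteq> 0} \<in> X" and t: "t \<in> {0..1}"
  shows "straight t x y \<in> realization X"
proof -
  note iff = realization_iff[OF finite_complexD(1)[OF X] order_refl]
  have "{u. straight t x y u \<noteq> 0} \<subseteq> {u. x u \<noteq> 0} \<union> {u. y u \<noteq> 0}"
    by (auto simp: straight_def)
  then have "{u. straight t x y u \<noteq> 0} \<in> X"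
    using finite_complexD(2)[OF X xy] by blast
  moreover have "sum (straight t x y) (\<Union>X) = 1"
    using x y by (simp add: iff straight_def sum.distrib flip: sum_distrib_left)
  moreover have "0 \<le> straight t x y u" for u
    using x y t by (simp add: iff straight_def)
  ultimately show ?thesis by (simp add: iff)
qed

lemma continuous_on_coordinate:
  fixes r :: "'b::topological_space \<Rightarrow> 'a \<Rightarrow> real"
  assumes "continuous_on A r"
  shows "continuous_on A (\<lambda>x. r x u)"
  by (rule continuous_on_compose2[OF continuous_on_product_coordinates assms]) auto

lemma continuous_on_straight:
  fixes f :: "'b::topological_space \<Rightarrow> real"
  assumes "continuous_on A f" "continuous_on A g" "continuous_on A h"
  shows "continuous_on A (\<lambda>x. straight (f x) (g x) (h x))"
  unfolding straight_def
proof (rule continuous_on_coordinatewise_then_product)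
  show "continuous_on A (\<lambda>x. (1 - f x) * g x u + f x * h x u)" for u
    using assms(1) continuous_on_coordinate[OF assms(2), of u] continuous_on_coordinate[OF assms(3), of u]
    by (intro continuous_on_add continuous_on_mult continuous_on_diff continuous_on_const)
qed

lemma continuous_on_straight_deformation:
  assumes "continuous_on A r"
  shows "continuous_on ({0..1} \<times> A) (\<lambda>z. straight (fst z) (snd z) (r (snd z)))"
proof (intro continuous_on_straight continuous_on_fst continuous_on_snd continuous_on_id)
  show "continuous_on ({0..1::real} \<times> A) (\<lambda>z. r (snd z))"
    by (rule continuous_on_compose2[OF assms continuous_on_snd[OF continuous_on_id]]) auto
qed

lemma path_component_straight:
  assumes X: "finite_complex X" and x: "x \<in> realization X" and y: "y \<in> realization X"
    and xy: "{u. x u \<noteq> 0} \<union> {u. y u \<noteq> 0} \<in> X"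
  shows "path_component (realization X) x y"
  unfolding path_component_def
proof (intro exI[where x = "\<lambda>t. straight t x y"] conjI)
  show "path (\<lambda>t. straight t x y)"
    unfolding path_def by (intro continuous_on_straight continuous_on_id continuous_on_const)
qed (use straight_in_realization[OF assms] in \<open>auto simp: path_image_def pathstart_def pathfinish_def\<close>)

section \<open>Vertices, edges and cones\<close>

definition vertex :: "'a \<Rightarrow> 'a \<Rightarrow> real" where
  "vertex u = (\<lambda>w. if w = u then 1 else 0)"

lemma support_vertex [simp]: "{w. vertex u w \<noteq> 0} = {u}"
  by (auto simp: vertex_def)

lemma vertex_in_realization: "{u} \<in> X \<Longrightarrow> vertex u \<in> realization X"
  unfolding realization_def mem_Collect_eq support_vertex by (auto simp: vertex_def)

lemma path_component_vertex:
  assumes X: "finite_complex X" and x: "x \<in> realization X" and u: "x u \<noteq> 0"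
  shows "path_component (realization X) x (vertex u)"
proof -
  have s: "{w. x w \<noteq> 0} \<in> X" using x by (simp add: realization_def)
  have "{u} \<in> X" using finite_complexD(2)[OF X s] u by blast
  moreover have "{w. x w \<noteq> 0} \<union> {u} = {w. x w \<noteq> 0}" using u by blast
  ultimately show ?thesis
    using s by (intro path_component_straight[OF X x vertex_in_realization]) auto
qed

lemma path_component_vertices:
  assumes X: "finite_complex X" and e: "{u, w} \<in> X"
  shows "path_component (realization X) (vertex u) (vertex w)"
proof (intro path_component_straight[OF X] vertex_in_realization)
  show "{u} \<in> X" "{w} \<in> X" using finite_complexD(2)[OF X e] by auto
qed (use e in \<open>simp add: insert_commute\<close>)

lemma support_nonempty: "x \<in> realization X \<Longrightarrow> \<exists>u. x u \<noteq> 0"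
  by (rule ccontr) (auto simp: realization_def)

text \<open>The segment from any point to the apex \<open>vertex v\<close> stays in the realization,
  which therefore contracts to the apex.\<close>

lemma simply_connected_cone:
  assumes X: "finite_complex X" and v: "{v} \<in> X" and cone: "\<And>\<sigma>. \<sigma> \<in> X \<Longrightarrow> insert v \<sigma> \<in> X"
  shows "simply_connected_complex X"
proof -
  have vX: "vertex v \<in> realization X" using v by (rule vertex_in_realization)
  have sing: "simply_connected {vertex v}"
    unfolding simply_connected_iff_trivial_loops
  proof (intro conjI allI impI path_connected_singleton)
    fix p :: "real \<Rightarrow> 'a \<Rightarrow> real"
    assume "path p \<and> path_image p \<subseteq> {vertex v} \<and> pathfinish p = pathstart p"
    then show "homotopic_paths {vertex v} p (\<lambda>_. pathstart p)"
      by (intro homotopic_paths_eq) (auto simp: path_image_def pathstart_def image_subset_iff)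
  qed
  have str: "straight t x (vertex v) \<in> realization X" if "t \<in> {0..1}" "x \<in> realization X" for t x
  proof (rule straight_in_realization[OF X that(2) vX _ that(1)])
    have "{u. x u \<noteq> 0} \<in> X" using that(2) by (simp add: realization_def)
    then have "insert v {u. x u \<noteq> 0} \<in> X" by (rule cone)
    then show "{u. x u \<noteq> 0} \<union> {u. vertex v u \<noteq> 0} \<in> X" by simp
  qed
  have "continuous_on (realization X) (\<lambda>_. vertex v)" by (rule continuous_on_const)
  then have "simply_connected (realization X)"
    by (rule simply_connected_deformation[OF continuous_on_straight_deformation, where T = "{vertex v}"])
       (use vX sing str in simp_all)
  then show ?thesis using vX by (auto simp: simply_connected_complex_def)
qed

section \<open>Open thickenings of subcomplexes\<close>

definition thickening :: "real \<Rightarrow> 'a set set \<Rightarrow> 'a set set \<Rightarrow> ('a \<Rightarrow> real) set" where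
  "thickening e X L = {x \<in> realization X. {u. e \<le> x u} \<in> L}"

text \<open>Only coordinates of size at least \<open>e\<close> have to span a simplex of
  \<open>L\<close>. Equivalently, for some simplex of \<open>L\<close>, each of the finitely many
  other vertices has coordinate below \<open>e\<close>, which is an open condition.\<close>

lemma openin_thickening:
  assumes X: "finite_complex X" and L: "finite_complex L" and e: "0 < e"
  shows "openin (top_of_set (realization X)) (thickening e X L)"
proof -
  define T where "T = (\<Union>\<sigma>\<in>L. \<Inter>u\<in>\<Union>X - \<sigma>. {x. x u < e})"
  have "open T"
    unfolding T_def using finite_complexD(1)[OF X]
    by (intro open_UN open_INT ballI finite_Diff open_Collect_less continuous_on_const continuous_on_product_coordinates)
  moreover have "thickening e X L = realization X \<inter> T"
  proof (intro equalityI subsetI)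
    fix x assume "x \<in> thickening e X L"
    then show "x \<in> realization X \<inter> T"
      by (auto simp: thickening_def T_def not_le intro!: bexI[of _ "{u. e \<le> x u}"])
  next
    fix x assume x: "x \<in> realization X \<inter> T"
    then obtain \<sigma> where s: "\<sigma> \<in> L" "\<forall>u\<in>\<Union>X - \<sigma>. x u < e" by (auto simp: T_def)
    have "u \<in> \<sigma>" if "e \<le> x u" for u
    proof -
      have "x u \<noteq> 0" using that e by auto
      then have "u \<in> \<Union>X" using x by (auto simp: realization_def)
      then show ?thesis using s that by force
    qed
    then have "{u. e \<le> x u} \<subseteq> \<sigma>" by blast
    then show "x \<in> thickening e X L"
      using x finite_complexD(2)[OF L s(1)] by (simp add: thickening_def)
  qed
  ultimately show ?thesis by (simp add: openin_open_Int)
qed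

lemma realization_subset_thickening:
  assumes L: "finite_complex L" and sub: "L \<subseteq> X" and e: "0 < e"
  shows "realization L \<subseteq> thickening e X L"
proof
  fix x assume x: "x \<in> realization L"
  have "{u. x u \<noteq> 0} \<in> L" using x by (simp add: realization_def)
  moreover have "{u. e \<le> x u} \<subseteq> {u. x u \<noteq> 0}" using e by auto
  ultimately have "{u. e \<le> x u} \<in> L" by (rule finite_complexD(2)[OF L])
  then show "x \<in> thickening e X L"
    using x realization_mono[OF sub] by (auto simp: thickening_def)
qed

text \<open>Truncating the coordinates at \<open>e\<close> and renormalising pushes the thickening into the subcomplex;
  since some coordinate is at least \<open>1 / card (\<Union>X) > e\<close>, the normalising sum does not vanish.\<close>

lemma thickening_deformation:
  fixes e :: real
  assumes X: "finite_complex X" and L: "finite_complex L" and sub: "L \<subseteq> X"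
    and e: "0 < e" "e * card (\<Union>X) < 1"
  obtains r where "continuous_on (thickening e X L) r"
    "\<And>x. x \<in> thickening e X L \<Longrightarrow> r x \<in> realization L"
    "\<And>t x. \<lbrakk>t \<in> {0..1}; x \<in> thickening e X L\<rbrakk> \<Longrightarrow> straight t x (r x) \<in> thickening e X L"
proof
  define V where "V = \<Union>X"
  note iff = realization_iff[OF finite_complexD(1)[OF X] order_refl, folded V_def]
  define n where "n x = (\<Sum>w\<in>V. max 0 (x w - e))" for x :: "'a \<Rightarrow> real"
  define r where "r x = (\<lambda>u. max 0 (x u - e) / n x)" for x :: "'a \<Rightarrow> real"
  have npos: "0 < n x" if "x \<in> realization X" for x
  proof -
    \<comment> \<open>The coordinates sum to 1, so subtracting \<open>e\<close> at each vertex
      leaves a total of \<open>1 - e * card V\<close>, which is positive.\<close>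
    have "1 - e * card V = (\<Sum>w\<in>V. x w - e)"
      using that by (simp add: iff sum_subtractf mult.commute)
    also have "\<dots> \<le> n x" unfolding n_def by (intro sum_mono) auto
    finally show ?thesis using e by (simp add: V_def)
  qed
  show "continuous_on (thickening e X L) r"
    unfolding r_def
  proof (rule continuous_on_coordinatewise_then_product)
    have cut: "continuous_on (thickening e X L) (\<lambda>x. max 0 (x u - e))" for u
      using continuous_on_coordinate[OF continuous_on_id]
      by (intro continuous_on_max continuous_on_diff continuous_on_const)
    have "continuous_on (thickening e X L) n"
      unfolding n_def by (intro continuous_on_sum cut)
    moreover have "\<forall>x\<in>thickening e X L. n x \<noteq> 0"
      using npos by (force simp: thickening_def)
    ultimately show "continuous_on (thickening e X L) (\<lambda>x. max 0 (x u - e) / n x)" for u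
      using cut by (intro continuous_on_divide)
  qed
  show rL: "r x \<in> realization L" if x: "x \<in> thickening e X L" for x
  proof -
    have xX: "x \<in> realization X" and xL: "{u. e \<le> x u} \<in> L" using x by (auto simp: thickening_def)
    have "{u. r x u \<noteq> 0} \<subseteq> {u. e \<le> x u}" by (auto simp: r_def)
    then have "{u. r x u \<noteq> 0} \<in> L" using xL finite_complexD(2)[OF L] by blast
    moreover have "sum (r x) V = 1"
      using npos[OF xX] by (simp add: r_def n_def flip: sum_divide_distrib)
    moreover have "\<forall>u. 0 \<le> r x u" using npos[OF xX] by (simp add: r_def)
    moreover have "finite V" "\<Union>L \<subseteq> V" using finite_complexD(1)[OF X] sub by (auto simp: V_def)
    ultimately show ?thesis by (simp add: realization_iff[of V])
  qed
  show "straight t x (r x) \<in> thickening e X L" if t: "t \<in> {0..1}" and x: "x \<in> thickening e X L" for t x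
  proof -
    have xX: "x \<in> realization X" and xL: "{u. e \<le> x u} \<in> L" using x by (auto simp: thickening_def)
    \<comment> \<open>Truncation creates no new support, so the segment from \<open>x\<close> to
      \<open>r x\<close> stays in one simplex of \<open>X\<close>.\<close>
    have "{u. x u \<noteq> 0} \<union> {u. r x u \<noteq> 0} = {u. x u \<noteq> 0}" using e by (auto simp: r_def)
    then have "straight t x (r x) \<in> realization X"
      using xX rL[OF x] realization_mono[OF sub] t
      by (intro straight_in_realization[OF X]) (simp_all add: subset_iff realization_def[of X])
    \<comment> \<open>A coordinate below \<open>e\<close> is truncated to 0 in \<open>r x\<close>;
      it can only shrink along the segment and never reaches \<open>e\<close>.\<close>
    moreover have "e \<le> x u" if u: "e \<le> straight t x (r x) u" for u
    proof (rule ccontr)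
      assume "\<not> e \<le> x u"
      then have "straight t x (r x) u = (1 - t) * x u" by (simp add: straight_def r_def)
      also have "\<dots> \<le> 1 * x u" using t xX by (intro mult_right_mono) (auto simp: iff)
      finally show False using u \<open>\<not> e \<le> x u\<close> by simp
    qed
    then have "{u. e \<le> straight t x (r x) u} \<in> L"
      by (intro finite_complexD(2)[OF L xL]) blast
    ultimately show ?thesis by (simp add: thickening_def)
  qed
qed

text \<open>The realizations of \<open>L\<close> and \<open>M\<close> are closed, so their open
  thickenings are glued instead. These deform into \<open>realization L\<close> and
  \<open>realization M\<close>, and their intersection into
  \<open>realization (L \<inter> M)\<close>.\<close>

theorem simply_connected_complex_Un:
  assumes L: "finite_complex L" and M: "finite_complex M"
    and sc: "simply_connected_complex L" "simply_connected_complex M"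
    and pc: "path_connected_complex (L \<inter> M)"
  shows "simply_connected_complex (L \<union> M)"
proof -
  define X where "X = L \<union> M"
  have X: "finite_complex X" and LM: "finite_complex (L \<inter> M)"
    using L M by (auto simp: X_def finite_complex_Un finite_complex_Int)
  \<comment> \<open>Adding 1 keeps the denominator positive and makes
    \<open>e * card (\<Union>X) < 1\<close> strict.\<close>
  define e where "e = 1 / (real (card (\<Union>X)) + 1)"
  have e: "0 < e" "e * card (\<Union>X) < 1" by (auto simp: e_def field_simps)
  have deform: "P (realization N) \<Longrightarrow> P (thickening e X N)"
    if N: "finite_complex N" "N \<subseteq> X" and P: "P = simply_connected \<or> P = path_connected" for N P
  proof -
    obtain r where r: "continuous_on (thickening e X N) r"
      "\<And>x. x \<in> thickening e X N \<Longrightarrow> r x \<in> realization N"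
      "\<And>t x. \<lbrakk>t \<in> {0..1}; x \<in> thickening e X N\<rbrakk> \<Longrightarrow> straight t x (r x) \<in> thickening e X N"
      using thickening_deformation[OF X N e] by blast
    note deformation = continuous_on_straight_deformation[OF r(1)]
    have "realization N \<subseteq> thickening e X N"
      using realization_subset_thickening[OF N e(1)] .
    then show "P (realization N) \<Longrightarrow> P (thickening e X N)"
      using P simply_connected_deformation[OF deformation, of "realization N"]
        path_connected_deformation[OF deformation, of "realization N"] r(2,3) by auto
  qed
  \<comment> \<open>Membership depends on the single set \<open>{u. e \<le> x u}\<close>, so
    thickenings turn unions and intersections of complexes into unions and intersections of
    sets.\<close>
  have cover: "thickening e X L \<union> thickening e X M = realization X"
  proof -
    have "{u. e \<le> x u} \<in> X" if x: "x \<in> realization X" for x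
    proof -
      have "x \<in> thickening e X X" using realization_subset_thickening[OF X order_refl e(1)] x by blast
      then show ?thesis by (simp add: thickening_def)
    qed
    then show ?thesis by (auto simp: thickening_def X_def)
  qed
  have int: "thickening e X L \<inter> thickening e X M = thickening e X (L \<inter> M)"
    by (auto simp: thickening_def)
  have "simply_connected (thickening e X L \<union> thickening e X M)"
  proof (rule simply_connected_Un_open)
    show "simply_connected (thickening e X L)" "simply_connected (thickening e X M)"
      using sc L M by (auto simp: simply_connected_complex_def X_def intro!: deform[unfolded X_def])
    show "path_connected (thickening e X L \<inter> thickening e X M)"
      using pc LM unfolding int by (auto simp: path_connected_complex_def X_def intro!: deform[unfolded X_def])
    show "thickening e X L \<inter> thickening e X M \<noteq> {}"
      using pc realization_subset_thickening[OF LM _ e(1), of X]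
      unfolding int by (auto simp: path_connected_complex_def X_def)
  qed (use openin_thickening[OF X _ e(1)] L M in \<open>simp_all add: cover\<close>)
  moreover have "realization X \<noteq> {}"
    using sc(1) realization_mono[of L X] by (auto simp: simply_connected_complex_def X_def)
  ultimately show ?thesis
    by (simp add: simply_connected_complex_def cover X_def[symmetric])
qed

text \<open>Turns topological connectedness into induction along simplices. The total weight on
  \<open>T\<close> is continuous; since a simplex meeting \<open>T\<close> lies in \<open>T\<close>,
  it takes only the values 0 and 1. A vertex outside \<open>T\<close> would force the value
  \<open>1/2\<close> as well.\<close>

lemma connected_complex_vertices_subset:
  assumes X: "finite_complex X" and conn: "Topological_Spaces.connected (realization X)"
    and s: "{s} \<in> X" "s \<in> T"
    and T: "\<And>\<sigma>. \<lbrakk>\<sigma> \<in> X; \<sigma> \<inter> T \<noteq> {}\<rbrakk> \<Longrightarrow> \<sigma> \<subseteq> T"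
  shows "\<Union>X \<subseteq> T"
proof (rule ccontr)
  assume "\<not> \<Union>X \<subseteq> T"
  then obtain u \<sigma> where u: "\<sigma> \<in> X" "u \<in> \<sigma>" "u \<notin> T" by blast
  have uX: "{u} \<in> X" using finite_complexD(2)[OF X u(1)] u(2) by blast
  define f where "f x = sum x (\<Union>X \<inter> T)" for x :: "'a \<Rightarrow> real"
  have fin: "finite (\<Union>X \<inter> T)" using finite_complexD(1)[OF X] by blast
  have "continuous_on (realization X) f"
    unfolding f_def by (intro continuous_on_sum continuous_on_coordinate[OF continuous_on_id])
  then have "Topological_Spaces.connected (f ` realization X)" using conn by (rule connected_continuous_image)
  moreover have "f (vertex s) = 1" "f (vertex u) = 0"
    using s u fin by (auto simp: f_def vertex_def)
  then have "1 \<in> f ` realization X" "0 \<in> f ` realization X"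
    using vertex_in_realization[OF s(1)] vertex_in_realization[OF uX] by (metis imageI)+
  ultimately have "1/2 \<in> f ` realization X"
    using connectedD_interval[of "f ` realization X" 0 1 "1/2"] by simp
  then obtain x where x: "x \<in> realization X" "f x = 1/2" by auto
  note iff = realization_iff[OF finite_complexD(1)[OF X] order_refl]
  have sx: "{w. x w \<noteq> 0} \<in> X" "sum x (\<Union>X) = 1" using x(1) by (auto simp: iff)
  show False
  proof (cases "{w. x w \<noteq> 0} \<inter> T = {}")
    case True
    then have "f x = 0" unfolding f_def by (intro sum.neutral) blast
    then show ?thesis using x by simp
  next
    case False
    then have "{w. x w \<noteq> 0} \<subseteq> T" using T sx by blast
    then have "f x = sum x (\<Union>X)"
      unfolding f_def using finite_complexD(1)[OF X] by (intro sum.mono_neutral_left) auto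
    then show ?thesis using x sx by simp
  qed
qed


section \<open>Deleting a vertex\<close>

lemma finite_complex_nbhd_complex:
  assumes "finite (verts G)"
  shows "finite_complex (nbhd_complex G)"
proof -
  have "\<Union>(nbhd_complex G) \<subseteq> verts G" by (auto simp: nbhd_complex_def)
  then have "finite (\<Union>(nbhd_complex G))" using assms finite_subset by metis
  moreover have "\<tau> \<in> nbhd_complex G" if "\<sigma> \<in> nbhd_complex G" "\<tau> \<subseteq> \<sigma>" for \<sigma> \<tau>
    using that unfolding nbhd_complex_def mem_Collect_eq by (meson subset_iff)
  ultimately show ?thesis by (simp add: finite_complex_def)
qed

lemma dominates_del_vert:
  "u \<rightarrow>\<^bsub>pre_digraph.del_vert G v\<^esub> w \<longleftrightarrow> u \<rightarrow>\<^bsub>G\<^esub> w \<and> u \<noteq> v \<and> w \<noteq> v"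
  by (auto simp: arcs_ends_def pre_digraph.del_vert_def arc_to_ends_def)

theorem theorem3p3:
  fixes G :: "('a, 'b) pre_digraph" and v :: 'a
  assumes "graph G"
    and "Digraph_Component.connected G"
    and "v \<in> verts G"
    and "path_connected_complex
           (induced_subcomplex (nbhd_complex (pre_digraph.del_vert G v)) (neighbourhood G v))"
    and "simply_connected_complex (nbhd_complex (pre_digraph.del_vert G v))"
  shows "simply_connected_complex (nbhd_complex G)"
proof -
  interpret graph G by fact
  define adj where "adj u w \<longleftrightarrow> u \<rightarrow>\<^bsub>G\<^esub> w" for u w
  have adj: "adj u w \<Longrightarrow> adj w u" "\<not> adj u u" "adj u w \<Longrightarrow> u \<in> verts G" "adj u w \<Longrightarrow> w \<in> verts G" for u w
    unfolding adj_def by (auto simp: graph_symmetric dest: adj_not_same)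
  define L where "L = nbhd_complex (pre_digraph.del_vert G v)"
  define S where "S = neighbourhood G v"
  \<comment> \<open>The closed star of \<open>v\<close> in the complex of \<open>G\<close>: a common
    neighbour \<open>w\<close> in \<open>S\<close> is adjacent to \<open>v\<close> too, so
    \<open>v\<close> can be added to the simplex. \<open>link\<close> collects those of its
    simplices that avoid \<open>v\<close>.\<close>
  define star where "star = {\<sigma>. \<exists>w\<in>S. \<forall>u\<in>\<sigma>. adj w u}"
  define link where "link = {\<sigma>. v \<notin> \<sigma> \<and> (\<exists>w\<in>S. \<forall>u\<in>\<sigma>. adj w u)}"
  have S: "S = {u. adj v u}" using adj by (auto simp: S_def neighbourhood_def adj_def)
  have L: "L = {\<sigma>. \<sigma> \<subseteq> verts G - {v} \<and> (\<exists>w\<in>verts G - {v}. \<forall>u\<in>\<sigma>. adj w u)}"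
    by (auto simp: L_def nbhd_complex_def verts_del_vert dominates_del_vert adj_def)
  \<comment> \<open>Simplices are sorted by a common neighbour \<open>w\<close>: for
    \<open>w = v\<close> they lie in \<open>S\<close>; for \<open>w \<noteq> v\<close> they lie in
    \<open>star\<close> or in \<open>L\<close> according to whether they contain
    \<open>v\<close>.\<close>
  have K: "nbhd_complex G = (L \<union> Pow S) \<union> star"
  proof (intro equalityI subsetI)
    fix \<sigma> assume "\<sigma> \<in> nbhd_complex G"
    then obtain w where w: "w \<in> verts G" "\<sigma> \<subseteq> verts G" "\<forall>u\<in>\<sigma>. adj w u"
      by (auto simp: nbhd_complex_def adj_def)
    consider "w = v" | "w \<noteq> v" "v \<in> \<sigma>" | "w \<noteq> v" "v \<notin> \<sigma>" by blast
    then show "\<sigma> \<in> (L \<union> Pow S) \<union> star"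
    proof cases
      case 1
      then have "\<sigma> \<subseteq> S" using w by (auto simp: S)
      then show ?thesis by blast
    next
      case 2
      then have "w \<in> S" using w adj(1) by (simp add: S)
      then show ?thesis using w by (auto simp: star_def)
    next
      case 3
      then have "\<sigma> \<in> L" using w by (auto simp: L)
      then show ?thesis by blast
    qed
  next
    fix \<sigma> assume "\<sigma> \<in> (L \<union> Pow S) \<union> star"
    then consider "\<sigma> \<in> L" | "\<sigma> \<subseteq> S" | "\<sigma> \<in> star" by blast
    then have "\<sigma> \<subseteq> verts G \<and> (\<exists>w\<in>verts G. \<forall>u\<in>\<sigma>. adj w u)"
    proof cases
      case 1
      then show ?thesis by (auto simp: L)
    next
      case 2
      then have "\<forall>u\<in>\<sigma>. adj v u" by (auto simp: S)
      then show ?thesis using \<open>v \<in> verts G\<close> adj(4) by blast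
    next
      case 3
      then obtain w where "w \<in> S" "\<forall>u\<in>\<sigma>. adj w u" by (auto simp: star_def)
      then show ?thesis using adj(3,4) adj(4)[of v w] by (auto simp: S)
    qed
    then show "\<sigma> \<in> nbhd_complex G" by (auto simp: nbhd_complex_def adj_def)
  qed
  \<comment> \<open>No simplex of \<open>L\<close> or \<open>Pow S\<close> contains
    \<open>v\<close>. Conversely, the common neighbour in \<open>S\<close> of a simplex of
    \<open>link\<close> differs from \<open>v\<close>, so the simplex survives in
    \<open>L\<close>.\<close>
  have link: "(L \<union> Pow S) \<inter> star = link"
  proof (intro equalityI subsetI)
    fix \<sigma> assume s: "\<sigma> \<in> (L \<union> Pow S) \<inter> star"
    then have "v \<notin> \<sigma>" using adj(2) by (auto simp: L S)
    then show "\<sigma> \<in> link" using s by (simp add: star_def link_def)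
  next
    fix \<sigma> assume "\<sigma> \<in> link"
    then obtain w where w: "v \<notin> \<sigma>" "w \<in> S" "\<forall>u\<in>\<sigma>. adj w u" by (auto simp: link_def)
    then have "w \<in> verts G" "w \<noteq> v" using adj(2,4) by (auto simp: S)
    moreover have "\<sigma> \<subseteq> verts G - {v}" using w adj(4) by auto
    ultimately have "\<sigma> \<in> L" using w(3) by (auto simp: L)
    then show "\<sigma> \<in> (L \<union> Pow S) \<inter> star" using w by (auto simp: star_def)
  qed
  have fin: "finite (verts G)" by simp
  have fL: "finite_complex L"
    unfolding L_def by (intro finite_complex_nbhd_complex) (simp add: verts_del_vert fin)
  have fS: "finite_complex (Pow S)"
    using fin by (auto simp: finite_complex_def S_def neighbourhood_def)
  have "\<Union>star \<subseteq> verts G" using adj by (auto simp: star_def)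
  then have "finite (\<Union>star)" using fin finite_subset by metis
  moreover have "\<tau> \<in> star" if "\<sigma> \<in> star" "\<tau> \<subseteq> \<sigma>" for \<sigma> \<tau>
    using that unfolding star_def mem_Collect_eq by (meson subset_iff)
  ultimately have fstar: "finite_complex star" by (simp add: finite_complex_def)
  have flink: "finite_complex link"
    using link finite_complex_Int[OF finite_complex_Un[OF fL fS] fstar] by simp
  have LS: "path_connected_complex (L \<inter> Pow S)" and scL: "simply_connected_complex L"
    using assms(4,5) by (simp_all add: L_def S_def induced_subcomplex_def Pow_def Int_def)
  have fLS: "finite_complex (L \<inter> Pow S)" using fL fS by (rule finite_complex_Int)
  obtain x where x: "x \<in> realization (L \<inter> Pow S)"
    using LS by (auto simp: path_connected_complex_def)
  then obtain w0 where w0: "x w0 \<noteq> 0" using support_nonempty by blast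
  have w0LS: "{w0} \<in> L \<inter> Pow S"
    using w0 x finite_complexD(2)[OF fLS, of "{u. x u \<noteq> 0}" "{w0}"] by (auto simp: realization_def)
  \<comment> \<open>\<open>{w0} \<in> L\<close> means that \<open>w0\<close> has a neighbour other
    than \<open>v\<close>. This \<open>y0\<close> serves as base vertex of \<open>link\<close>,
    \<open>w0\<close> as apex of the simplex on \<open>S\<close>.\<close>
  then obtain y0 where y0: "w0 \<in> S" "adj w0 y0" "y0 \<noteq> v"
    using adj(1) by (auto simp: L)
  have "simply_connected_complex (Pow S)"
    by (rule simply_connected_cone[OF fS, of w0]) (use y0 in auto)
  then have step1: "simply_connected_complex (L \<union> Pow S)"
    by (intro simply_connected_complex_Un fL fS scL LS)
  have scstar: "simply_connected_complex star"
    using y0 adj by (intro simply_connected_cone[OF fstar, of v]) (auto simp: star_def S)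
  \<comment> \<open>The vertices of \<open>S\<close> whose neighbours other than \<open>v\<close>
    all lie in the component of \<open>y0\<close> in \<open>link\<close>. By \<open>edge\<close>
    below, the neighbours of one \<open>w\<close> in \<open>S\<close> always lie in a single
    component.\<close>
  define T where "T = {w \<in> S. \<forall>u. adj w u \<and> u \<noteq> v \<longrightarrow> path_component (realization link) (vertex y0) (vertex u)}"
  have edge: "path_component (realization link) (vertex u) (vertex u')"
    if "w \<in> S" "adj w u" "adj w u'" "u \<noteq> v" "u' \<noteq> v" for w u u'
    using that by (intro path_component_vertices[OF flink]) (auto simp: link_def)
  have "\<Union>(L \<inter> Pow S) \<subseteq> T"
  proof (rule connected_complex_vertices_subset[OF fLS _ w0LS])
    show "Topological_Spaces.connected (realization (L \<inter> Pow S))"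
      using LS by (auto simp: path_connected_complex_def intro: path_connected_imp_connected)
    show "w0 \<in> T" using y0 edge by (auto simp: T_def)
    fix \<sigma> assume s: "\<sigma> \<in> L \<inter> Pow S" "\<sigma> \<inter> T \<noteq> {}"
    \<comment> \<open>A common neighbour \<open>y\<close> of the simplex transports membership in
      \<open>T\<close>: a vertex in \<open>T\<close> joins \<open>y\<close> to \<open>y0\<close>,
      and \<open>y\<close> is joined to each neighbour of any other vertex \<open>w'\<close> of the
      simplex.\<close>
    then obtain y where "y \<noteq> v" "\<forall>w\<in>\<sigma>. adj y w"
      by (auto simp: L)
    then have y: "y \<noteq> v" "\<And>w. w \<in> \<sigma> \<Longrightarrow> adj w y"
      using adj(1) by simp_all
    obtain w where w: "w \<in> \<sigma>" "w \<in> T" using s(2) by blast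
    then have y0y: "path_component (realization link) (vertex y0) (vertex y)"
      using y by (auto simp: T_def)
    show "\<sigma> \<subseteq> T"
    proof
      fix w' assume w': "w' \<in> \<sigma>"
      then have "w' \<in> S" using s by blast
      then show "w' \<in> T"
        unfolding T_def using path_component_trans[OF y0y edge[of w' y]] y w' by auto
    qed
  qed
  have toy0: "path_component (realization link) (vertex y0) z" if z: "z \<in> realization link" for z
  proof -
    obtain u where u: "z u \<noteq> 0" using z support_nonempty by blast
    have "{u. z u \<noteq> 0} \<in> link" using z by (simp add: realization_def)
    then obtain w where w: "w \<in> S" "adj w u" "u \<noteq> v" using u by (auto simp: link_def)
    have "w \<in> verts G - {v}" "u \<in> verts G - {v}" "adj u w"
      using w adj by (auto simp: S)
    \<comment> \<open>The neighbour \<open>u\<close> of \<open>w\<close> differs from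
      \<open>v\<close>, so \<open>w\<close> is a vertex of \<open>L\<close> and the inclusion in
      \<open>T\<close> applies to it.\<close>
    then have "{w} \<in> L \<inter> Pow S" using w(1) by (auto simp: L)
    then have "w \<in> T" using \<open>\<Union>(L \<inter> Pow S) \<subseteq> T\<close> by blast
    then have "path_component (realization link) (vertex y0) (vertex u)"
      using w by (auto simp: T_def)
    then show ?thesis
      using path_component_vertex[OF flink z u] path_component_sym path_component_trans by metis
  qed
  have "path_connected (realization link)"
    unfolding path_connected_component using toy0 path_component_sym path_component_trans by metis
  moreover have "vertex y0 \<in> realization link"
    using y0 by (intro vertex_in_realization) (auto simp: link_def)
  ultimately have "path_connected_complex link"
    by (auto simp: path_connected_complex_def)
  then show ?thesis
    unfolding K
    by (intro simply_connected_complex_Un finite_complex_Un fL fS fstar step1 scstar) (simp add: link)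
qed

end
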